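(* Let $\mathcal{R}\subset\mathbb{R}^N\setminus\{0\}$ be a reduced root system and $k$ a non-negative multiplicity function with $2\langle k\rangle+N>1$. Let $a\in\{1,2\}$, $r,s>0$, $t\in[-1,1]$, and $z\in\mathbb{C}$ with $\operatorname{Re}z\ge0$, $z\notin i\pi\mathbb{Z}$. Then $$h_{k,a}(r,s;z;t)=\frac{\exp(-\frac1a(r^a+s^a)\coth(z))}{\sinh(z)^{\frac{2\langle k\rangle+N+a-2}{a}}}\times\begin{cases}\Gamma\big(\langle k\rangle+\frac{N-1}{2}\big)\,\widetilde I_{\langle k\rangle+\frac{N-3}{2}}\Big(\frac{\sqrt2\,(rs)^{\frac12}}{\sinh z}(1+t)^{\frac12}\Big)&(a=1),\\[1ex]\exp\Big(\frac{rst}{\sinh z}\Big)&(a=2).\end{cases}$$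
   Context: A (reduced) root system is a finite set $\mathcal{R}\subset\mathbb{R}^N\setminus\{0\}$ ($N\ge1$) stable under the reflections $r_\alpha$, $\alpha\in\mathcal{R}$, with $\mathcal{R}\cap\mathbb{R}\alpha=\{\pm\alpha\}$; a multiplicity function $k=(k_\alpha)$ on $\mathcal{R}$ is a function invariant under the group generated by the $r_\alpha$; non-negative means all $k_\alpha\ge0$; $\langle k\rangle=\frac12\sum_{\alpha\in\mathcal{R}}k_\alpha$. $\widetilde I_\lambda(w)=\big(\frac w2\big)^{-\lambda}I_\lambda(w)=\sum_{\ell=0}^\infty\frac{w^{2\ell}}{2^{2\ell}\ell!\,\Gamma(\lambda+\ell+1)}$ is the normalized $I$-Bessel function (an entire even function of $w$), and $C_m^\nu(t)$ the Gegenbauer polynomials, $(1-2rt+r^2)^{-\nu}=\sum_{m\ge0}C_m^\nu(t)r^m$. For $b>0$, $1+b\nu>0$, $w\in\mathbb{C}$, $t\in[-1,1]$ put $$\mathcal{I}(b,\nu;w;t)=\frac{\Gamma(b\nu+1)}{\nu}\sum_{m=0}^\infty(m+\nu)\Big(\frac w2\Big)^{bm}\widetilde I_{b(m+\nu)}(w)\,C_m^\nu(t)$$ (for $\nu=0$ the expression $\frac1\nu(m+\nu)C_m^\nu(t)$ is understood as its limit as $\nu\to0$, equal to $1$ for $m=0$). Then, by definition, $$h_{k,a}(r,s;z;t)=\frac{\exp\big(-\frac1a(r^a+s^a)\coth(z)\big)}{\sinh(z)^{\frac{2\langle k\rangle+N+a-2}{a}}}\;\mathcal{I}\Big(\frac2a,\frac{2\langle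 k\rangle+N-2}{2};\frac{2(rs)^{\frac a2}}{a\sinh(z)};t\Big),$$ where powers of $\sinh z$ use the branch continuous on $\{\operatorname{Re}z\ge0\}\setminus i\pi\mathbb{Z}$ and positive for $z>0$. *)

theory Defs
  imports "HOL-Complex_Analysis.Complex_Analysis" "HOL-Algebra.Bij" "HOL-Algebra.Generated_Groups"
begin

section \<open>Root systems and multiplicity functions\<close>

definition reflection :: "real ^ 'n \<Rightarrow> real ^ 'n \<Rightarrow> real ^ 'n" where
  "reflection \<alpha> x = x - (2 * inner \<alpha> x / inner \<alpha> \<alpha>) *\<^sub>R \<alpha>"

definition reduced_root_system :: "(real ^ 'n) set \<Rightarrow> bool" where
  "reduced_root_system R \<longleftrightarrow>
     finite R \<and> 0 \<notin> R \<and>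
     (\<forall>\<alpha>\<in>R. reflection \<alpha> ` R = R) \<and>
     (\<forall>\<alpha>\<in>R. R \<inter> range (\<lambda>c. c *\<^sub>R \<alpha>) = {\<alpha>, - \<alpha>})"

definition reflection_group :: "(real ^ 'n) set \<Rightarrow> (real ^ 'n \<Rightarrow> real ^ 'n) set" where
  "reflection_group R = generate (BijGroup UNIV) (reflection ` R)"

text \<open>Only the values of \<open>k\<close> on \<open>R\<close> are relevant.\<close>

definition multiplicity_function :: "(real ^ 'n) set \<Rightarrow> (real ^ 'n \<Rightarrow> real) \<Rightarrow> bool" where
  "multiplicity_function R k \<longleftrightarrow> (\<forall>g\<in>reflection_group R. \<forall>\<alpha>\<in>R. k (g \<alpha>) = k \<alpha>)"

definition mult_index :: "(real ^ 'n) set \<Rightarrow> (real ^ 'n \<Rightarrow> real) \<Rightarrow> real" where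
  "mult_index R k = (1 / 2) * (\<Sum>\<alpha>\<in>R. k \<alpha>)"


section \<open>Powers of the hyperbolic sine\<close>

text \<open>
  The logarithm of \<open>sinh\<close> on the closed right half-plane without \<open>i \<pi> \<int>\<close>, coming from
  \<open>sinh z = exp z * (1 - exp (-2 z)) / 2\<close>. The argument of the principal \<open>Ln\<close> has positive real
  part there, whereas \<open>Ln (sinh z)\<close> is discontinuous. The lemmas below show that it is the
  unique continuous logarithm of \<open>sinh\<close> that is real on the positive half-axis.
\<close>

definition log_sinh :: "complex \<Rightarrow> complex" where
  "log_sinh z = z + Ln (1 - exp (- 2 * z)) - of_real (ln 2)"

definition sinh_power :: "complex \<Rightarrow> real \<Rightarrow> complex" where
  "sinh_power z \<mu> = exp (of_real \<mu> * log_sinh z)"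

definition sinh_domain :: "complex set" where
  "sinh_domain = {z. Re z \<ge> 0} - range (\<lambda>n::int. \<i> * of_real pi * of_int n)"

lemma sinh_domain_Re_pos:
  assumes "z \<in> sinh_domain"
  shows "Re (1 - exp (- 2 * z)) > 0"
proof -
  have le: "norm (exp (- 2 * z)) \<le> 1"
    using assms by (simp add: sinh_domain_def)
  have ne: "exp (- 2 * z) \<noteq> 1"
  proof
    assume "exp (- 2 * z) = 1"
    then obtain n :: int where n: "Re (- 2 * z) = 0" "Im (- 2 * z) = of_int (2 * n) * pi"
      unfolding exp_eq_1 by auto
    then have "z = \<i> * of_real pi * of_int (- n)"
      by (auto simp: complex_eq_iff)
    then show False
      using assms unfolding sinh_domain_def by blast
  qed
  have "Re (exp (- 2 * z)) \<noteq> 1"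
  proof
    assume 1: "Re (exp (- 2 * z)) = 1"
    have "(Re (exp (- 2 * z)))\<^sup>2 + (Im (exp (- 2 * z)))\<^sup>2 \<le> 1"
      using le by (metis cmod_power2 norm_ge_zero power_le_one)
    then have "Im (exp (- 2 * z)) = 0"
      using 1 by simp
    with 1 ne show False
      by (simp add: complex_eq_iff)
  qed
  moreover have "Re (exp (- 2 * z)) \<le> 1"
    using le complex_Re_le_cmod order_trans by blast
  ultimately show ?thesis
    by simp
qed

lemma log_sinh_branch:
  "continuous_on sinh_domain log_sinh"
  "z \<in> sinh_domain \<Longrightarrow> exp (log_sinh z) = sinh z"
  "x > 0 \<Longrightarrow> log_sinh (of_real x) = of_real (ln (sinh x))"
proof -
  show "continuous_on sinh_domain log_sinh"
    unfolding log_sinh_def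
    by (intro continuous_intros)
      (metis sinh_domain_Re_pos complex_nonpos_Reals_iff not_less)
next
  assume "z \<in> sinh_domain"
  then have "1 - exp (- 2 * z) \<noteq> 0"
    using sinh_domain_Re_pos by force
  then have "exp (log_sinh z) = exp z * (1 - exp (- 2 * z)) / 2"
    by (simp add: log_sinh_def exp_diff exp_add exp_of_real flip: of_real_exp)
  also have "\<dots> = sinh z"
  proof -
    have "exp z * exp (- (2 * z)) = exp (- z)"
      by (simp flip: exp_add)
    then show ?thesis
      by (simp add: sinh_field_def algebra_simps)
  qed
  finally show "exp (log_sinh z) = sinh z" .
next
  assume x: "x > 0"
  have pos: "1 - exp (- 2 * x) > 0"
    using x by simp
  have "Ln (1 - exp (- 2 * of_real x)) = Ln (of_real (1 - exp (- 2 * x)))"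
    by (simp flip: exp_of_real)
  also have "\<dots> = of_real (ln (1 - exp (- 2 * x)))"
    using pos by (rule Ln_of_real)
  finally have "log_sinh (of_real x) = of_real (x + ln (1 - exp (- 2 * x)) - ln 2)"
    by (simp add: log_sinh_def)
  moreover have "sinh x = exp x * (1 - exp (- 2 * x)) / 2"
  proof -
    have "exp x * exp (- (2 * x)) = exp (- x)"
      by (simp flip: exp_add)
    then show ?thesis
      by (simp add: sinh_field_def algebra_simps)
  qed
  then have "ln (sinh x) = ln (exp x * (1 - exp (- 2 * x))) - ln 2"
    using pos by (simp only: ln_divide_pos mult_pos_pos exp_gt_zero zero_less_numeral)
  then have "ln (sinh x) = x + ln (1 - exp (- 2 * x)) - ln 2"
    using pos by (simp only: ln_mult_pos exp_gt_zero ln_exp)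
  ultimately show "log_sinh (of_real x) = of_real (ln (sinh x))"
    by simp
qed

lemma log_sinh_unique:
  assumes "continuous_on sinh_domain L"
    and "\<And>z. z \<in> sinh_domain \<Longrightarrow> exp (L z) = sinh z"
    and "\<And>x::real. x > 0 \<Longrightarrow> L (of_real x) \<in> \<real>"
    and z: "z \<in> sinh_domain"
  shows "L z = log_sinh z"
proof -
  let ?D = "\<lambda>z. L z - log_sinh z"
  have conn: "connected sinh_domain"
  proof (rule connected_intermediate_closure)
    show "connected {z. Re z > 0}"
      by (intro convex_connected convex_halfspace_Re_gt)
    show "{z. Re z > 0} \<subseteq> sinh_domain"
      by (auto simp: sinh_domain_def)
    have "closure {z. Re z > 0} = {z. Re z \<ge> 0}"
      using closure_halfspace_gt[of "1::complex" 0] by (simp add: inner_complex_def)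
    then show "sinh_domain \<subseteq> closure {z. Re z > 0}"
      by (auto simp: sinh_domain_def)
  qed
  have vals: "\<exists>n::int. ?D x = of_int (2 * n) * of_real pi * \<i>" if "x \<in> sinh_domain" for x
  proof -
    have "exp (L x) = exp (log_sinh x)"
      using assms(2)[OF that] log_sinh_branch(2)[OF that] by simp
    then obtain n :: int where "L x = log_sinh x + of_int (2 * n) * of_real pi * \<i>"
      by (auto simp: exp_eq)
    then show ?thesis by auto
  qed
  have "?D constant_on sinh_domain"
  proof (rule continuous_discrete_range_constant[OF conn])
    show "continuous_on sinh_domain ?D"
      by (intro continuous_intros assms log_sinh_branch)
    show "\<exists>e>0. \<forall>y. y \<in> sinh_domain \<and> ?D y \<noteq> ?D x \<longrightarrow> e \<le> norm (?D y - ?D x)"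
      if x: "x \<in> sinh_domain" for x
    proof (intro exI[of _ 1] conjI allI impI)
      fix y assume y: "y \<in> sinh_domain \<and> ?D y \<noteq> ?D x"
      obtain m n :: int where mn: "?D x = of_int (2 * m) * of_real pi * \<i>"
          "?D y = of_int (2 * n) * of_real pi * \<i>"
        using vals x y by meson
      have "?D y - ?D x = of_int (2 * (n - m)) * of_real pi * \<i>"
        unfolding mn by (simp add: algebra_simps)
      then have eq: "norm (?D y - ?D x) = \<bar>of_int (2 * (n - m))\<bar> * pi"
        by (simp add: norm_mult flip: of_int_mult of_int_diff)
      have "n \<noteq> m"
        using y mn by auto
      then have "1 \<le> \<bar>2 * (n - m)\<bar>"
        by presburger
      then have "1 \<le> \<bar>real_of_int (2 * (n - m))\<bar>"
        by (metis of_int_1_le_iff of_int_abs)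
      moreover have "1 \<le> pi"
        using pi_ge_two by linarith
      ultimately have "1 * 1 \<le> \<bar>real_of_int (2 * (n - m))\<bar> * pi"
        by (intro mult_mono) auto
      then show "1 \<le> norm (?D y - ?D x)"
        using eq by simp
    qed simp
  qed
  moreover have 1: "(1::complex) \<in> sinh_domain"
    by (auto simp: sinh_domain_def complex_eq_iff)
  ultimately have eq: "?D z = ?D 1"
    using z unfolding constant_on_def by metis
  have "?D 1 \<in> \<real>"
    using assms(3)[of 1] log_sinh_branch(3)[of 1] by simp
  moreover obtain n :: int where "?D 1 = of_int (2 * n) * of_real pi * \<i>"
    using vals[OF 1] by blast
  ultimately have "?D 1 = 0"
    by (auto simp: complex_is_Real_iff complex_eq_iff)
  with eq show ?thesis by simp
qed


section \<open>Normalized Bessel functions and Gegenbauer polynomials\<close>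

definition bessel_I_norm :: "real \<Rightarrow> complex \<Rightarrow> complex" where
  "bessel_I_norm \<mu> w =
     (\<Sum>l. w ^ (2 * l) / (2 ^ (2 * l) * fact l * of_real (Gamma (\<mu> + real l + 1))))"

text \<open>
  The coefficient of \<open>X ^ m\<close> in \<open>(1 - 2 t X + X\<^sup>2) powr (- \<nu>)\<close>, where
  \<open>fps_binomial c\<close> is the series of \<open>(1 + X) powr c\<close>. The lemma below states the
  generating function identity as a power series expansion at 0.
\<close>

definition gegenbauer :: "nat \<Rightarrow> real \<Rightarrow> real \<Rightarrow> real" where
  "gegenbauer m \<nu> t =
     fps_nth (fps_binomial (- \<nu>) oo (fps_X\<^sup>2 - fps_const (2 * t) * fps_X)) m"

lemma gegenbauer_generating_function:
  "(\<lambda>r::complex. (1 - 2 * r * of_real t + r\<^sup>2) powr of_real (- \<nu>))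
     has_fps_expansion Abs_fps (\<lambda>m. of_real (gegenbauer m \<nu> t))"
proof -
  let ?cp = "\<lambda>f :: real fps. Abs_fps (\<lambda>n. of_real (fps_nth f n)) :: complex fps"
  let ?g = "fps_X\<^sup>2 - fps_const (2 * t) * fps_X"
  let ?G = "fps_X\<^sup>2 - fps_const (2 * of_real t) * fps_X :: complex fps"
  have cp_mult: "?cp (f * g) = ?cp f * ?cp g" for f g
    by (simp add: fps_eq_iff fps_mult_nth)
  have cp_one: "?cp 1 = 1"
    by (simp add: fps_eq_iff)
  have cp_power: "?cp (f ^ i) = ?cp f ^ i" for f i
    by (induction i) (simp_all only: power_0 power_Suc cp_one cp_mult)
  have cp_g: "?cp ?g = ?G"
    by (simp add: fps_eq_iff fps_X_power_nth fps_X_nth)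
  have pow: "of_real (fps_nth (?g ^ i) n) = fps_nth (?G ^ i) n" for i n
    using cp_power[of ?g i] cp_g by (metis fps_nth_Abs_fps)
  have bin: "of_real ((- \<nu>) gchoose i) = ((of_real (- \<nu>) :: complex) gchoose i)" for i
    by (simp add: gbinomial_prod_rev of_real_prod)
  have "Abs_fps (\<lambda>m. of_real (gegenbauer m \<nu> t)) = fps_binomial (of_real (- \<nu>)) oo ?G"
    by (simp add: fps_eq_iff gegenbauer_def fps_compose_nth pow bin[simplified])
  moreover have "((\<lambda>x. (1 + x) powr of_real (- \<nu>)) \<circ> (\<lambda>r. r\<^sup>2 - 2 * of_real t * r))
      has_fps_expansion (fps_binomial (of_real (- \<nu>)) oo ?G)"
  proof (rule has_fps_expansion_compose)
    show "(\<lambda>x. (1 + x) powr complex_of_real (- \<nu>)) has_fps_expansion fps_binomial (of_real (- \<nu>))"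
      by (rule has_fps_expansion_binomial_complex)
    show "(\<lambda>r. r\<^sup>2 - 2 * of_real t * r) has_fps_expansion ?G"
      by (intro fps_expansion_intros)
    show "fps_nth ?G 0 = 0"
      by simp
  qed
  ultimately show ?thesis
    by (simp add: o_def algebra_simps)
qed


section \<open>The kernel\<close>

definition gegenbauer_factor :: "nat \<Rightarrow> real \<Rightarrow> real \<Rightarrow> real" where
  "gegenbauer_factor m \<nu> t =
     (if \<nu> = 0 then Lim (at 0) (\<lambda>\<mu>. (real m + \<mu>) / \<mu> * gegenbauer m \<mu> t)
      else (real m + \<nu>) / \<nu> * gegenbauer m \<nu> t)"

text \<open>The limit in the previous definition exists, and it equals 1 for \<open>m = 0\<close>.\<close>

lemma gegenbauer_factor_limit:
  "((\<lambda>\<mu>. (real m + \<mu>) / \<mu> * gegenbauer m \<mu> t) \<longlongrightarrow> gegenbauer_factor m 0 t) (at 0)"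
  "gegenbauer_factor 0 0 t = 1"
proof -
  let ?f = "\<lambda>m \<mu>. (real m + \<mu>) / \<mu> * gegenbauer m \<mu> t"
  let ?p = "fps_X\<^sup>2 - fps_const (2 * t) * fps_X"
  have zero: "(?f 0 \<longlongrightarrow> 1) (at 0)"
    by (rule tendsto_eventually)
      (auto simp: gegenbauer_def eventually_at_filter)
  have ex: "\<exists>L. (?f m \<longlongrightarrow> L) (at 0)"
  proof (cases "m = 0")
    case True
    with zero show ?thesis by auto
  next
    case False
    let ?F = "\<lambda>\<mu>. \<Sum>i = 1..m. - (real m + \<mu>) / real i * ((- \<mu> - 1) gchoose (i - 1)) * fps_nth (?p ^ i) m"
    have "?f m \<mu> = ?F \<mu>" if "\<mu> \<noteq> 0" for \<mu>
    proof -
      have "gegenbauer m \<mu> t = (\<Sum>i = 1..m. ((- \<mu>) gchoose i) * fps_nth (?p ^ i) m)"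
        using False by (simp add: gegenbauer_def fps_compose_nth sum.atLeast_Suc_atMost)
      also have "\<dots> = (\<Sum>i = 1..m. (- \<mu> / real i) * ((- \<mu> - 1) gchoose (i - 1)) * fps_nth (?p ^ i) m)"
        by (intro sum.cong refl) (subst gbinomial_absorption', auto)
      finally show ?thesis
        using that by (simp add: sum_distrib_left) (rule sum.cong, auto simp: field_simps)
    qed
    then have "\<forall>\<^sub>F \<mu> in at 0. ?F \<mu> = ?f m \<mu>"
      by (auto simp: eventually_at_filter)
    moreover have "isCont ?F 0"
      unfolding gbinomial_prod_rev by (intro continuous_intros) auto
    then have "(?F \<longlongrightarrow> ?F 0) (at 0)"
      by (simp only: isCont_def)
    ultimately have "(?f m \<longlongrightarrow> ?F 0) (at 0)"
      by (rule Lim_transform_eventually[rotated])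
    then show ?thesis ..
  qed
  then obtain L where L: "(?f m \<longlongrightarrow> L) (at 0)" ..
  have "Lim (at 0) (?f m) = L"
    by (rule tendsto_Lim[OF trivial_limit_at L])
  then have "gegenbauer_factor m 0 t = L"
    unfolding gegenbauer_factor_def by (rule trans[OF if_P[OF refl]])
  then show "(?f m \<longlongrightarrow> gegenbauer_factor m 0 t) (at 0)"
    by (rule ssubst) (rule L)
  show "gegenbauer_factor 0 0 t = 1"
    unfolding gegenbauer_factor_def
    by (rule trans[OF if_P[OF refl] tendsto_Lim[OF trivial_limit_at zero]])
qed

text \<open>
  The case distinction on \<open>m\<close> is needed at \<open>w = 0\<close> only, since \<open>0 powr 0 = 0\<close>.
  For \<open>b\<close> a positive integer, which is the case for \<open>b = 2 / a\<close> with \<open>a \<in> {1, 2}\<close>, the exponent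
  \<open>b * m\<close> is a natural number and the branch of \<open>powr\<close> plays no role.
\<close>

definition scr_I :: "real \<Rightarrow> real \<Rightarrow> complex \<Rightarrow> real \<Rightarrow> complex" where
  "scr_I b \<nu> w t =
     of_real (Gamma (b * \<nu> + 1)) *
     (\<Sum>m. (if m = 0 then 1 else (w / 2) powr of_real (b * real m)) *
           bessel_I_norm (b * (real m + \<nu>)) w * of_real (gegenbauer_factor m \<nu> t))"

definition h_kernel ::
  "(real ^ 'n) set \<Rightarrow> (real ^ 'n \<Rightarrow> real) \<Rightarrow> real \<Rightarrow> real \<Rightarrow> real \<Rightarrow> complex \<Rightarrow> real \<Rightarrow> complex" where
  "h_kernel R k a r s z t =
     exp (- of_real (1 / a * (r powr a + s powr a)) * (cosh z / sinh z))
       / sinh_power z ((2 * mult_index R k + real CARD('n) + a - 2) / a)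
     * scr_I (2 / a) ((2 * mult_index R k + real CARD('n) - 2) / 2)
         (of_real (2 * (r * s) powr (a / 2)) / (of_real a * sinh z)) t"

end

theory Submission
  imports Defs
begin

text \<open>
  Both sides carry the same exponential factor and the same power of \<open>sinh z\<close>, so the claim is a
  closed form of \<open>scr_I b \<nu> w t\<close> for \<open>b = 2 / a \<in> {1, 2}\<close> and \<open>\<nu> > - 1 / 2\<close>: for \<open>b = 1\<close> it is
  \<open>exp (w t)\<close>, for \<open>b = 2\<close> it is a single Bessel function of \<open>w sqrt ((1 + t) / 2)\<close>.

  Write \<open>c\<^sub>m\<close> for \<open>(m + \<nu>) / \<nu> C\<^sub>m\<^sup>\<nu>(t)\<close> (a limit if \<open>\<nu> = 0\<close>). Inserting the Bessel series turns
  \<open>scr_I\<close> into a double series over \<open>(m, l)\<close>. Since \<open>c\<^sub>m\<close> grows at most geometrically in \<open>m\<close>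
  (\<open>gegenbauer_factor_bound\<close>) while the Gamma function in the denominator grows like a factorial,
  it converges absolutely and may be summed by powers of \<open>w\<close> instead (\<open>scr_I_sums\<close>). Each
  coefficient is then a finite combination of \<open>c\<^sub>0, \<dots>, c\<^sub>n\<close>, and the identity to be shown says that
  this combination is the Gegenbauer expansion of \<open>(2 t) ^ n / n!\<close> for \<open>b = 1\<close>, and of a multiple
  of \<open>((1 + t) / 2) ^ n\<close> for \<open>b = 2\<close>.

  These two expansions (\<open>power_gegenbauer_expansion\<close> and \<open>shifted_power_gegenbauer_expansion\<close>)
  follow by induction on \<open>n\<close>: by the three-term recurrence, multiplication by \<open>2 t\<close> takes \<open>c\<^sub>m\<close> to
  a combination of \<open>c\<^sub>m\<^sub>+\<^sub>1\<close> and \<open>c\<^sub>m\<^sub>-\<^sub>1\<close>, and the explicit coefficients satisfy the resulting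
  recurrence in \<open>n\<close>. Substituted back, the expansions leave the exponential series and the Bessel
  series, respectively.
\<close>

section \<open>Gegenbauer polynomials\<close>

lemma gegenbauer_0: "gegenbauer 0 \<nu> t = 1"
  by (simp add: gegenbauer_def)

text \<open>
  With \<open>G(X) = (1 - 2 t X + X\<^sup>2) powr (- \<nu>)\<close> and \<open>P = X\<^sup>2 - 2 t X\<close>, this is the equation
  \<open>(1 + P) G' = - \<nu> G P'\<close>, obtained by composing \<open>(1 + X) B' = - \<nu> B\<close> for the binomial series
  with \<open>P\<close>. Comparing coefficients in it gives the three-term recurrence.
\<close>

lemma gegenbauer_ODE:
  fixes \<nu> t :: real
  defines "P \<equiv> fps_X\<^sup>2 - fps_const (2 * t) * fps_X"
  shows "(1 + P) * fps_deriv (fps_binomial (- \<nu>) oo P)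
    = fps_const (- \<nu>) * (fps_binomial (- \<nu>) oo P) * fps_deriv P"
proof -
  let ?B = "fps_binomial (- \<nu>)"
  have P0: "fps_nth P 0 = 0"
    by (simp add: P_def)
  have "(1 + fps_X) * fps_deriv ?B = fps_const (- \<nu>) * ?B"
    by (simp add: fps_binomial_deriv fps_divide_unit mult.assoc inverse_mult_eq_1' mult.left_commute)
  then have "((1 + fps_X) * fps_deriv ?B) oo P = (fps_const (- \<nu>) * ?B) oo P"
    by simp
  then have "(1 + P) * (fps_deriv ?B oo P) = fps_const (- \<nu>) * (?B oo P)"
    by (simp add: fps_compose_mult_distrib[OF P0] fps_compose_add_distrib P0 del: fps_const_neg)
  then show ?thesis
    by (simp add: fps_compose_deriv[OF P0] mult.assoc[symmetric])
qed

lemma gegenbauer_recurrence: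
  "2 * t * (real (Suc m) + \<nu>) * gegenbauer (Suc m) \<nu> t
    = real (m + 2) * gegenbauer (m + 2) \<nu> t + (real m + 2 * \<nu>) * gegenbauer m \<nu> t"
  "gegenbauer 1 \<nu> t = 2 * \<nu> * t"
proof -
  let ?P = "fps_X\<^sup>2 - fps_const (2 * t) * fps_X"
  define G where "G = fps_binomial (- \<nu>) oo ?P"
  have eq: "(1 + ?P) * fps_deriv G = fps_const (- \<nu>) * G * fps_deriv ?P"
    unfolding G_def by (rule gegenbauer_ODE)
  have dP: "fps_deriv ?P = fps_const 2 * fps_X - fps_const (2 * t)"
    by (simp add: fps_deriv_power numeral_fps_const)
  have L: "(1 + ?P) * fps_deriv G
      = fps_deriv G + fps_X * (fps_X * fps_deriv G) - fps_const (2 * t) * (fps_X * fps_deriv G)"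
    by (simp add: algebra_simps power2_eq_square)
  have R: "fps_const (- \<nu>) * G * fps_deriv ?P
      = fps_const (- 2 * \<nu>) * (fps_X * G) + fps_const (2 * \<nu> * t) * G"
    unfolding dP by (simp add: algebra_simps flip: fps_const_mult fps_const_neg)
  have nth: "fps_nth G m = gegenbauer m \<nu> t" for m
    by (simp add: G_def gegenbauer_def)
  have c: "fps_nth (fps_deriv G + fps_X * (fps_X * fps_deriv G) - fps_const (2 * t) * (fps_X * fps_deriv G)) m
     = fps_nth (fps_const (- 2 * \<nu>) * (fps_X * G) + fps_const (2 * \<nu> * t) * G) m" for m
    using eq unfolding L R by simp
  show "gegenbauer 1 \<nu> t = 2 * \<nu> * t"
    using c[of 0] by (simp add: nth gegenbauer_0)
  show "2 * t * (real (Suc m) + \<nu>) * gegenbauer (Suc m) \<nu> t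
    = real (m + 2) * gegenbauer (m + 2) \<nu> t + (real m + 2 * \<nu>) * gegenbauer m \<nu> t"
    using c[of "Suc m"] by (cases m) (simp_all add: nth algebra_simps)
qed

text \<open>
  The coefficient of \<open>c\<^sub>m\<close> in \<open>2 t c\<^sub>m\<^sub>+\<^sub>1\<close>. The quotient \<open>(m + 2 \<nu>) / (m + \<nu>)\<close> equals 2 for \<open>m = 0\<close>
  and \<open>\<nu> \<noteq> 0\<close>; fixing this value also at \<open>\<nu> = 0\<close> makes the coefficient continuous in \<open>\<nu>\<close>.
\<close>

definition lowering_coeff :: "real \<Rightarrow> nat \<Rightarrow> real" where
  "lowering_coeff \<nu> m = (if m = 0 then 2 else (real m + 2 * \<nu>) / (real m + \<nu>))"

lemma gegenbauer_factor_0: "gegenbauer_factor 0 \<nu> t = 1"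
  by (cases "\<nu> = 0")
    (simp_all only: gegenbauer_factor_limit(2), simp add: gegenbauer_factor_def gegenbauer_0)

lemma gegenbauer_factor_recurrence_nonzero:
  fixes \<nu> t :: real
  assumes "\<nu> > - 1 / 2" "\<nu> \<noteq> 0"
  defines "c \<equiv> \<lambda>m. (real m + \<nu>) / \<nu> * gegenbauer m \<nu> t"
  shows "2 * t * c 0 = 1 / (1 + \<nu>) * c 1"
    and "2 * t * c (Suc m) = real (m + 2) / (real (m + 2) + \<nu>) * c (m + 2) + lowering_coeff \<nu> m * c m"
proof -
  have pos: "real (Suc m) + \<nu> > 0" for m
    using assms(1) by simp
  show "2 * t * c 0 = 1 / (1 + \<nu>) * c 1"
    using pos[of 0] assms(2) by (simp add: c_def gegenbauer_0 gegenbauer_recurrence(2)[simplified])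
  have "2 * t * c (Suc m) = (2 * t * (real (Suc m) + \<nu>) * gegenbauer (Suc m) \<nu> t) / \<nu>"
    by (simp add: c_def)
  also have "\<dots> = real (m + 2) * gegenbauer (m + 2) \<nu> t / \<nu>
      + (real m + 2 * \<nu>) * gegenbauer m \<nu> t / \<nu>"
    by (simp only: gegenbauer_recurrence(1) add_divide_distrib)
  also have "real (m + 2) * gegenbauer (m + 2) \<nu> t / \<nu> = real (m + 2) / (real (m + 2) + \<nu>) * c (m + 2)"
    using pos[of "Suc m"] by (simp add: c_def)
  also have "(real m + 2 * \<nu>) * gegenbauer m \<nu> t / \<nu> = lowering_coeff \<nu> m * c m"
  proof (cases m)
    case 0
    then show ?thesis using assms(2) by (simp add: c_def lowering_coeff_def)
  next
    case (Suc k)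
    then show ?thesis using pos[of k] by (simp add: c_def lowering_coeff_def)
  qed
  finally show "2 * t * c (Suc m) = real (m + 2) / (real (m + 2) + \<nu>) * c (m + 2) + lowering_coeff \<nu> m * c m" .
qed

text \<open>
  For \<open>\<nu> \<noteq> 0\<close> this is the classical recurrence rescaled. The case \<open>\<nu> = 0\<close> is its limit, as all
  coefficients are continuous in \<open>\<nu>\<close> at 0.
\<close>

lemma gegenbauer_factor_recurrence:
  assumes \<nu>: "\<nu> > - 1 / 2"
  shows "2 * t * gegenbauer_factor 0 \<nu> t = 1 / (1 + \<nu>) * gegenbauer_factor 1 \<nu> t"
    and "2 * t * gegenbauer_factor (Suc m) \<nu> t
      = real (m + 2) / (real (m + 2) + \<nu>) * gegenbauer_factor (m + 2) \<nu> t
        + lowering_coeff \<nu> m * gegenbauer_factor m \<nu> t"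
proof -
  let ?c = "\<lambda>m \<mu>. (real m + \<mu>) / \<mu> * gegenbauer m \<mu> t"
  let ?f = "\<lambda>m. gegenbauer_factor m \<nu> t"
  have "2 * t * ?f 0 = 1 / (1 + \<nu>) * ?f 1 \<and>
    2 * t * ?f (Suc m) = real (m + 2) / (real (m + 2) + \<nu>) * ?f (m + 2) + lowering_coeff \<nu> m * ?f m"
  proof (cases "\<nu> = 0")
    case False
    then have "?f m = ?c m \<nu>" for m
      by (simp add: gegenbauer_factor_def)
    then show ?thesis
      using gegenbauer_factor_recurrence_nonzero[OF \<nu> False] by (simp only:)
  next
    case True
    have ev: "\<forall>\<^sub>F \<mu> in at 0. \<mu> > - 1 / 2 \<and> \<mu> \<noteq> (0::real)"
      by (intro eventually_conj eventually_neq_at_within order_tendstoD(1)[OF tendsto_ident_at]) simp_all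
    note lim = gegenbauer_factor_limit(1)[of _ t]
    have idt: "((\<lambda>\<mu>::real. \<mu>) \<longlongrightarrow> 0) (at 0)"
      by (rule tendsto_ident_at)
    have dc: "((\<lambda>\<mu>. lowering_coeff \<mu> m) \<longlongrightarrow> lowering_coeff 0 m) (at 0)"
    proof (cases "m = 0")
      case False
      then show ?thesis
        unfolding lowering_coeff_def by (simp only: if_False) (intro tendsto_intros idt, simp)
    qed (simp add: lowering_coeff_def)
    have "2 * t * gegenbauer_factor 0 0 t = 1 / (1 + 0) * gegenbauer_factor 1 0 t"
    proof (rule tendsto_unique[OF trivial_limit_at])
      show "((\<lambda>\<mu>. 2 * t * ?c 0 \<mu>) \<longlongrightarrow> 2 * t * gegenbauer_factor 0 0 t) (at 0)"
        by (intro tendsto_mult_left lim)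
      have "((\<lambda>\<mu>. 1 / (1 + \<mu>) * ?c 1 \<mu>) \<longlongrightarrow> 1 / (1 + 0) * gegenbauer_factor 1 0 t) (at 0)"
        by (intro tendsto_mult lim tendsto_divide tendsto_add tendsto_const idt) simp
      moreover have "\<forall>\<^sub>F \<mu> in at 0. 1 / (1 + \<mu>) * ?c 1 \<mu> = 2 * t * ?c 0 \<mu>"
        using ev by eventually_elim (rule gegenbauer_factor_recurrence_nonzero(1)[symmetric], auto)
      ultimately show "((\<lambda>\<mu>. 2 * t * ?c 0 \<mu>) \<longlongrightarrow> 1 / (1 + 0) * gegenbauer_factor 1 0 t) (at 0)"
        by (rule Lim_transform_eventually)
    qed
    moreover have "2 * t * gegenbauer_factor (Suc m) 0 t
      = real (m + 2) / (real (m + 2) + 0) * gegenbauer_factor (m + 2) 0 t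
        + lowering_coeff 0 m * gegenbauer_factor m 0 t"
    proof (rule tendsto_unique[OF trivial_limit_at])
      show "((\<lambda>\<mu>. 2 * t * ?c (Suc m) \<mu>) \<longlongrightarrow> 2 * t * gegenbauer_factor (Suc m) 0 t) (at 0)"
        by (intro tendsto_mult_left lim)
      have "((\<lambda>\<mu>. real (m + 2) / (real (m + 2) + \<mu>) * ?c (m + 2) \<mu> + lowering_coeff \<mu> m * ?c m \<mu>)
          \<longlongrightarrow> real (m + 2) / (real (m + 2) + 0) * gegenbauer_factor (m + 2) 0 t
            + lowering_coeff 0 m * gegenbauer_factor m 0 t) (at 0)"
        by (intro tendsto_mult dc lim tendsto_divide tendsto_add tendsto_const idt) simp
      moreover have "\<forall>\<^sub>F \<mu> in at 0. real (m + 2) / (real (m + 2) + \<mu>) * ?c (m + 2) \<mu>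
          + lowering_coeff \<mu> m * ?c m \<mu> = 2 * t * ?c (Suc m) \<mu>"
        using ev by eventually_elim (rule gegenbauer_factor_recurrence_nonzero(2)[symmetric], auto)
      ultimately show "((\<lambda>\<mu>. 2 * t * ?c (Suc m) \<mu>) \<longlongrightarrow>
          real (m + 2) / (real (m + 2) + 0) * gegenbauer_factor (m + 2) 0 t
            + lowering_coeff 0 m * gegenbauer_factor m 0 t) (at 0)"
        by (rule Lim_transform_eventually)
    qed
    ultimately show ?thesis
      unfolding True by (rule conjI)
  qed
  then show "2 * t * ?f 0 = 1 / (1 + \<nu>) * ?f 1"
    and "2 * t * ?f (Suc m) = real (m + 2) / (real (m + 2) + \<nu>) * ?f (m + 2) + lowering_coeff \<nu> m * ?f m"
    by blast+
qed

lemma lowering_coeff_bounds: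
  assumes "\<nu> > - 1 / 2"
  shows "0 \<le> lowering_coeff \<nu> m" "lowering_coeff \<nu> m \<le> 2 * (1 + \<bar>\<nu>\<bar>)"
proof -
  have "m > 0 \<Longrightarrow> real m \<ge> 1"
    by simp
  then show "0 \<le> lowering_coeff \<nu> m"
    using assms by (auto simp: lowering_coeff_def intro!: divide_nonneg_nonneg)
  have "real m + 2 * \<nu> \<le> 2 * (1 + \<bar>\<nu>\<bar>) * (real m + \<nu>)" if m: "m > 0"
  proof -
    have 1: "real m \<ge> 1"
      using m by simp
    then have "0 \<le> 2 * \<bar>\<nu>\<bar> * (real m + \<nu>)"
      using assms by (intro mult_nonneg_nonneg) auto
    then show ?thesis
      using 1 by (simp add: algebra_simps)
  qed
  then show "lowering_coeff \<nu> m \<le> 2 * (1 + \<bar>\<nu>\<bar>)"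
    using assms by (auto simp: lowering_coeff_def divide_le_eq)
qed

text \<open>
  A crude bound is enough for absolute convergence. The coefficients in the recurrence are bounded
  uniformly in \<open>m\<close>, so every sufficiently large base works.
\<close>

lemma gegenbauer_factor_bound:
  assumes "\<nu> > - 1 / 2" "t \<in> {-1..1}"
  shows "\<bar>gegenbauer_factor m \<nu> t\<bar> \<le> (4 * (1 + \<bar>\<nu>\<bar>)\<^sup>2) ^ m"
proof (induction m rule: less_induct)
  case (less m)
  let ?c = "\<lambda>m. gegenbauer_factor m \<nu> t"
  let ?a = "1 + \<bar>\<nu>\<bar>"
  define K where "K = 4 * ?a\<^sup>2"
  have aa: "?a \<le> ?a\<^sup>2" "1 \<le> ?a"
    by (auto simp: power2_eq_square algebra_simps)
  then have K1: "1 \<le> K"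
    by (simp add: K_def)
  have tt: "\<bar>t\<bar> \<le> 1"
    using assms(2) by auto
  have pos: "real (Suc m) + \<nu> > 0" for m
    using assms(1) by simp
  consider "m = 0" | "m = 1" | k where "m = k + 2"
    by (metis add_2_eq_Suc' not0_implies_Suc One_nat_def)
  then have "\<bar>?c m\<bar> \<le> K ^ m"
  proof cases
    case 1
    then show ?thesis by (simp add: gegenbauer_factor_0)
  next
    case 2
    have "?c 1 = 2 * (1 + \<nu>) * t"
      using gegenbauer_factor_recurrence(1)[OF assms(1), of t] pos[of 0]
      by (simp add: gegenbauer_factor_0 field_simps)
    then have "\<bar>?c 1\<bar> = 2 * \<bar>1 + \<nu>\<bar> * \<bar>t\<bar>"
      by (simp only: abs_mult abs_numeral)
    also have "\<dots> \<le> 2 * ?a * 1"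
      using tt by (intro mult_mono) auto
    also have "\<dots> \<le> K"
      using aa by (simp add: K_def)
    finally show ?thesis
      using 2 by simp
  next
    case 3
    let ?n = "real (k + 2)"
    have "?c (k + 2) = (?n + \<nu>) / ?n * (2 * t * ?c (Suc k) - lowering_coeff \<nu> k * ?c k)"
      using gegenbauer_factor_recurrence(2)[OF assms(1), of t k] pos[of "Suc k"]
      by (simp add: field_simps)
    then have "\<bar>?c (k + 2)\<bar> = \<bar>(?n + \<nu>) / ?n\<bar> * \<bar>2 * t * ?c (Suc k) - lowering_coeff \<nu> k * ?c k\<bar>"
      by (simp only: abs_mult)
    also have "\<dots> \<le> ?a * (2 * K ^ Suc k + 2 * ?a * K ^ k)"
    proof (intro mult_mono)
      have "\<bar>?n + \<nu>\<bar> \<le> ?a * ?n"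
        by (simp add: algebra_simps abs_le_iff) (smt (verit) mult_nonneg_nonneg of_nat_0_le_iff)
      then show "\<bar>(?n + \<nu>) / ?n\<bar> \<le> ?a"
        by (simp add: divide_le_eq)
      have "\<bar>2 * t * ?c (Suc k)\<bar> \<le> 2 * 1 * K ^ Suc k"
        unfolding abs_mult using tt less[of "Suc k"] 3 unfolding K_def by (intro mult_mono) auto
      moreover have "\<bar>lowering_coeff \<nu> k * ?c k\<bar> \<le> 2 * ?a * K ^ k"
        unfolding abs_mult using lowering_coeff_bounds[OF assms(1), of k] less[of k] 3
        unfolding K_def by (intro mult_mono) auto
      ultimately show "\<bar>2 * t * ?c (Suc k) - lowering_coeff \<nu> k * ?c k\<bar> \<le> 2 * K ^ Suc k + 2 * ?a * K ^ k"
        by linarith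
    qed auto
    also have "\<dots> = (2 * ?a * K + K / 2) * K ^ k"
      by (simp add: K_def power2_eq_square algebra_simps)
    also have "\<dots> \<le> K * K * K ^ k"
    proof (rule mult_right_mono)
      have "4 * ?a \<le> K"
        using aa by (simp add: K_def)
      then have "4 * ?a * K \<le> K * K"
        using K1 by (intro mult_right_mono) auto
      moreover have "1 * K \<le> ?a * K"
        using K1 by (intro mult_right_mono) auto
      ultimately show "2 * ?a * K + K / 2 \<le> K * K"
        using K1 by linarith
    qed (use K1 in auto)
    finally show ?thesis
      using 3 by (simp add: mult_ac)
  qed
  then show ?case by (simp add: K_def)
qed


section \<open>Expanding powers in Gegenbauer polynomials\<close>

text \<open>
  Multiplication by \<open>2 t\<close> acts on the sequence of Gegenbauer coefficients by the transpose of the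
  three-term recurrence. The sequence \<open>a\<close> vanishes beyond \<open>n\<close>, so that index shifts produce no
  boundary terms.
\<close>

lemma two_t_times_gegenbauer_sum:
  assumes \<nu>: "\<nu> > - 1 / 2" and a: "\<And>m. m > n \<Longrightarrow> a m = 0"
  shows "2 * t * (\<Sum>m\<le>n. a m * gegenbauer_factor m \<nu> t)
    = (\<Sum>m\<le>Suc n. ((case m of 0 \<Rightarrow> 0 | Suc j \<Rightarrow> real m / (real m + \<nu>) * a j)
        + lowering_coeff \<nu> m * a (Suc m)) * gegenbauer_factor m \<nu> t)"
proof -
  let ?c = "\<lambda>m. gegenbauer_factor m \<nu> t"
  let ?up = "\<lambda>m. (case m of 0 \<Rightarrow> 0 | Suc j \<Rightarrow> real m / (real m + \<nu>) * a j) * ?c m"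
  let ?dn = "\<lambda>m. case m of 0 \<Rightarrow> 0 | Suc j \<Rightarrow> lowering_coeff \<nu> j * a m * ?c j"
  have step: "2 * t * (a m * ?c m) = ?up (Suc m) + ?dn m" for m
  proof (cases m)
    case 0
    have "2 * t * (a 0 * ?c 0) = a 0 * (2 * t * ?c 0)"
      by simp
    also have "\<dots> = ?up (Suc 0)"
      by (subst gegenbauer_factor_recurrence(1)[OF \<nu>]) simp
    finally show ?thesis
      using 0 by simp
  next
    case (Suc j)
    have "2 * t * (a m * ?c m) = a m * (2 * t * ?c (Suc j))"
      by (simp add: Suc)
    also have "\<dots> = ?up (Suc m) + ?dn m"
      by (subst gegenbauer_factor_recurrence(2)[OF \<nu>]) (simp add: Suc algebra_simps)
    finally show ?thesis .
  qed
  have "2 * t * (\<Sum>m\<le>n. a m * ?c m) = (\<Sum>m\<le>n. ?up (Suc m)) + (\<Sum>m\<le>n. ?dn m)"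
    unfolding sum_distrib_left step sum.distrib ..
  also have "(\<Sum>m\<le>n. ?up (Suc m)) = (\<Sum>m\<le>Suc n. ?up m)"
    by (subst sum.atMost_Suc_shift) simp
  also have "(\<Sum>m\<le>n. ?dn m) = (\<Sum>m\<le>Suc (Suc n). ?dn m)"
    by (simp add: a)
  also have "\<dots> = (\<Sum>m\<le>Suc n. lowering_coeff \<nu> m * a (Suc m) * ?c m)"
    by (subst sum.atMost_Suc_shift) simp
  finally show ?thesis
    by (simp only: sum.distrib[symmetric] distrib_right)
qed

text \<open>
  The factor of \<open>c\<^sub>m (w / 2) ^ (d n)\<close> when the Bessel functions in \<open>scr_I d \<nu> w t\<close> are expanded and
  the terms are sorted by powers of \<open>w\<close>. The Bessel summand with index \<open>l\<close> contributes the power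
  \<open>d m + 2 l = d (m + q l)\<close>, where \<open>d q = 2\<close>; hence it occurs at \<open>n = m + q l\<close>, and \<open>l\<close> is determined
  by \<open>n\<close> and \<open>m\<close>. The two cases of interest are \<open>(q, d) = (2, 1)\<close> and \<open>(q, d) = (1, 2)\<close>.
\<close>

definition neumann_coeff :: "nat \<Rightarrow> nat \<Rightarrow> real \<Rightarrow> nat \<Rightarrow> nat \<Rightarrow> real" where
  "neumann_coeff q d \<nu> n m = (if m \<le> n \<and> q dvd n - m
     then 1 / (fact ((n - m) div q) * Gamma (real d * (real m + \<nu>) + real ((n - m) div q) + 1))
     else 0)"

lemma neumann_coeff_eq:
  "q > 0 \<Longrightarrow> neumann_coeff q d \<nu> (m + q * l) m
     = 1 / (fact l * Gamma (real d * (real m + \<nu>) + real l + 1))"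
  by (simp add: neumann_coeff_def)

lemma neumann_coeff_cases:
  obtains (on) l where "n = m + q * l" | (off) "neumann_coeff q d \<nu> n m = 0"
    "\<not> (m \<le> n \<and> q dvd n - m)"
  by (metis neumann_coeff_def dvdE le_add_diff_inverse)

text \<open>
  The coefficients of \<open>2 t f\<^sub>n\<close> and of \<open>(n + 1) f\<^sub>n\<^sub>+\<^sub>1\<close> agree, where \<open>f\<^sub>n\<close> has the coefficients
  \<open>neumann_coeff 2 1 \<nu> n\<close>. For \<open>n + 1 = m + 2 l\<close>, the functional equations of the factorial and of the
  Gamma function express every term as a rational multiple of the coefficient at \<open>(n + 1, m)\<close>, which
  leaves \<open>(m + 2 l) (m + \<nu>) = m (m + \<nu> + l) + (m + 2 \<nu>) l\<close>.
\<close>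

lemma neumann_coeff_2_1_recurrence:
  assumes \<nu>: "\<nu> > - 1 / 2"
  shows "real (Suc n) * neumann_coeff 2 1 \<nu> (Suc n) m
    = (case m of 0 \<Rightarrow> 0 | Suc j \<Rightarrow> real m / (real m + \<nu>) * neumann_coeff 2 1 \<nu> n j)
      + lowering_coeff \<nu> m * neumann_coeff 2 1 \<nu> n (Suc m)"
proof (cases rule: neumann_coeff_cases[where n = "Suc n" and m = m and q = 2 and d = 1 and \<nu> = \<nu>])
  case (on l)
  let ?X = "neumann_coeff 2 1 \<nu> (Suc n) m"
  have X: "?X = 1 / (fact l * Gamma (real m + \<nu> + real l + 1))"
    unfolding on by (simp add: neumann_coeff_eq)
  have next': "neumann_coeff 2 1 \<nu> n (Suc m) = real l * ?X"
  proof (cases l)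
    case 0
    then show ?thesis
      using on by (simp add: neumann_coeff_def)
  next
    case (Suc l')
    then have n: "n = Suc m + 2 * l'"
      using on by simp
    show ?thesis
      unfolding X unfolding n by (subst neumann_coeff_eq) (simp_all add: Suc add_ac)
  qed
  have n': "real (Suc n) = real m + 2 * real l"
    unfolding on by simp
  show ?thesis
  proof (cases m)
    case 0
    then show ?thesis
      unfolding next' n' by (simp add: lowering_coeff_def)
  next
    case (Suc j)
    have pos: "real m + \<nu> + real l > 0" "real m + \<nu> > 0"
      using \<nu> Suc by auto
    have n: "n = j + 2 * l"
      using on Suc by simp
    have prev: "neumann_coeff 2 1 \<nu> n j = (real m + \<nu> + real l) * ?X"
    proof -
      have "Gamma (real m + \<nu> + real l + 1) = (real m + \<nu> + real l) * Gamma (real m + \<nu> + real l)"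
        using pos by (intro Gamma_plus1) auto
      moreover have "neumann_coeff 2 1 \<nu> n j = 1 / (fact l * Gamma (real m + \<nu> + real l))"
        unfolding n by (subst neumann_coeff_eq) (simp_all add: Suc add_ac)
      ultimately show ?thesis
        unfolding X using pos by simp
    qed
    have "real (Suc n) * ?X = (real m + 2 * real l) * ?X"
      unfolding n' ..
    also have "\<dots> = real m / (real m + \<nu>) * ((real m + \<nu> + real l) * ?X)
        + lowering_coeff \<nu> m * (real l * ?X)"
    proof -
      have "real m + 2 * real l
          = (real m * (real m + \<nu> + real l) + (real m + 2 * \<nu>) * real l) / (real m + \<nu>)"
        using pos(2) by (subst nonzero_eq_divide_eq) (simp_all add: algebra_simps)
      also have "\<dots> = real m * (real m + \<nu> + real l) / (real m + \<nu>)
          + (real m + 2 * \<nu>) * real l / (real m + \<nu>)"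
        by (rule add_divide_distrib)
      finally have "real m + 2 * real l = real m / (real m + \<nu>) * (real m + \<nu> + real l)
          + (real m + 2 * \<nu>) / (real m + \<nu>) * real l"
        by (simp only: times_divide_eq_left)
      moreover have "lowering_coeff \<nu> m = (real m + 2 * \<nu>) / (real m + \<nu>)"
        using Suc by (simp add: lowering_coeff_def)
      ultimately show ?thesis
        by (simp only: ring_distribs(2) mult.assoc)
    qed
    finally show ?thesis
      unfolding next' using Suc prev by simp
  qed
next
  case off
  have "neumann_coeff 2 1 \<nu> n (Suc m) = 0"
    using off(2) by (auto simp: neumann_coeff_def)
  moreover have "neumann_coeff 2 1 \<nu> n j = 0" if "m = Suc j" for j
    using off(2) that by (auto simp: neumann_coeff_def)
  ultimately show ?thesis
    using off(1) by (auto split: nat.split)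
qed

text \<open>
  The same comparison for multiplication by \<open>2 + 2 t = 4 (1 + t) / 2\<close>. For \<open>n + 1 = m + l\<close>, every term
  is the coefficient at \<open>(n + 1, m)\<close> times a rational expression in \<open>l\<close>, \<open>m\<close> and \<open>\<nu>\<close>.
\<close>

lemma neumann_coeff_1_2_recurrence:
  assumes \<nu>: "\<nu> > - 1 / 2"
  shows "4 * real (Suc n) * (real n + \<nu> + 1 / 2) * neumann_coeff 1 2 \<nu> (Suc n) m
    = 2 * neumann_coeff 1 2 \<nu> n m
      + ((case m of 0 \<Rightarrow> 0 | Suc j \<Rightarrow> real m / (real m + \<nu>) * neumann_coeff 1 2 \<nu> n j)
         + lowering_coeff \<nu> m * neumann_coeff 1 2 \<nu> n (Suc m))"
proof (cases rule: neumann_coeff_cases[where n = "Suc n" and m = m and q = 1 and d = 2 and \<nu> = \<nu>])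
  case (on l)
  let ?X = "neumann_coeff 1 2 \<nu> (Suc n) m"
  \<comment> \<open>The denominator of the coefficient at \<open>(n + 1, m)\<close> is \<open>l! \<Gamma>(g + 1)\<close>.\<close>
  let ?g = "2 * (real m + \<nu>) + real l"
  have n: "real n = real m + real l - 1"
    using on by linarith
  have X: "?X = 1 / (fact l * Gamma (?g + 1))"
    unfolding on by (subst neumann_coeff_eq) simp_all
  have g: "?g > 0"
    using on \<nu> by (cases m) auto
  have G1: "Gamma (?g + 1) = ?g * Gamma ?g"
    using g by (intro Gamma_plus1) auto
  have same: "neumann_coeff 1 2 \<nu> n m = real l * ?g * ?X"
  proof (cases l)
    case 0
    then show ?thesis
      using on by (simp add: neumann_coeff_def)
  next
    case (Suc l')
    then have "n = m + 1 * l'"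
      using on by simp
    then have "neumann_coeff 1 2 \<nu> n m = 1 / (fact l' * Gamma ?g)"
      by (simp only: neumann_coeff_eq zero_less_one) (simp add: Suc add_ac)
    then show ?thesis
      unfolding X G1 using g by (simp add: Suc)
  qed
  have next': "neumann_coeff 1 2 \<nu> n (Suc m) = real l * (real l - 1) * ?X"
  proof (cases "l \<le> 1")
    case True
    then have "l = 0 \<or> l = 1"
      by auto
    then show ?thesis
      using on by (auto simp add: neumann_coeff_def)
  next
    case False
    then obtain l' where l': "l = Suc (Suc l')"
      by (metis One_nat_def Suc_le_D not_less_eq_eq)
    then have "n = Suc m + 1 * l'"
      using on by simp
    then have "neumann_coeff 1 2 \<nu> n (Suc m) = 1 / (fact l' * Gamma (?g + 1))"
      by (simp only: neumann_coeff_eq zero_less_one) (simp add: l' algebra_simps)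
    then show ?thesis
      unfolding X by (simp add: l')
  qed
  show ?thesis
  proof (cases m)
    case 0
    have "4 * real (Suc n) * (real n + \<nu> + 1 / 2) = 2 * (real l * ?g) + 2 * (real l * (real l - 1))"
      using 0 by (simp add: n algebra_simps)
    then have "4 * real (Suc n) * (real n + \<nu> + 1 / 2) * ?X
        = (2 * (real l * ?g) + 2 * (real l * (real l - 1))) * ?X"
      by (rule arg_cong)
    then show ?thesis
      unfolding same next' using 0 by (simp add: lowering_coeff_def ring_distribs(2) mult.assoc)
  next
    case (Suc j)
    have pos: "?g - 1 > 0" "real m + \<nu> > 0"
      using \<nu> Suc by auto
    have "n = j + 1 * l"
      using on Suc by simp
    then have "neumann_coeff 1 2 \<nu> n j = 1 / (fact l * Gamma (?g - 1))"
      by (simp only: neumann_coeff_eq zero_less_one) (simp add: Suc algebra_simps)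
    moreover have "Gamma ?g = (?g - 1) * Gamma (?g - 1)"
    proof -
      have "?g - 1 \<notin> \<int>\<^sub>\<le>\<^sub>0"
        using pos(1) by (metis nonpos_Ints_nonpos not_less)
      from Gamma_plus1[OF this] show ?thesis
        by simp
    qed
    ultimately have prev: "neumann_coeff 1 2 \<nu> n j = ?g * (?g - 1) * ?X"
      unfolding X G1 using pos g by simp
    have "4 * real (Suc n) * (real n + \<nu> + 1 / 2)
        = 2 * (real l * ?g) + real m / (real m + \<nu>) * (?g * (?g - 1))
          + (real m + 2 * \<nu>) / (real m + \<nu>) * (real l * (real l - 1))"
    proof -
      have "4 * real (Suc n) * (real n + \<nu> + 1 / 2) - 2 * (real l * ?g)
        = (real m * (?g * (?g - 1)) + (real m + 2 * \<nu>) * (real l * (real l - 1))) / (real m + \<nu>)"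
        using pos(2) by (subst nonzero_eq_divide_eq) (simp_all add: n algebra_simps)
      also have "\<dots> = real m * (?g * (?g - 1)) / (real m + \<nu>)
          + (real m + 2 * \<nu>) * (real l * (real l - 1)) / (real m + \<nu>)"
        by (rule add_divide_distrib)
      finally show ?thesis
        by (simp only: times_divide_eq_left)
    qed
    then have "4 * real (Suc n) * (real n + \<nu> + 1 / 2) * ?X
        = (2 * (real l * ?g) + real m / (real m + \<nu>) * (?g * (?g - 1))
          + (real m + 2 * \<nu>) / (real m + \<nu>) * (real l * (real l - 1))) * ?X"
      by (rule arg_cong)
    then show ?thesis
      unfolding same next' using Suc prev
      by (simp add: lowering_coeff_def ring_distribs(2) mult.assoc)
  qed
next
  case off
  have m: "m > Suc n"
    using off(2) by simp
  then show ?thesis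
    by (auto simp: neumann_coeff_def split: nat.split)
qed

lemma neumann_sum_0:
  assumes "real d * \<nu> + 1 > 0"
  shows "Gamma (real d * \<nu> + 1)
    * (\<Sum>m\<le>0. neumann_coeff q d \<nu> 0 m * gegenbauer_factor m \<nu> t) = 1"
  using less_imp_neq[OF Gamma_real_pos[OF assms]] by (simp add: neumann_coeff_def gegenbauer_factor_0)

text \<open>
  The expansion of \<open>t ^ n\<close> in Gegenbauer polynomials, in the normalization in which it occurs as a
  coefficient of \<open>scr_I 1 \<nu> w t\<close>.
\<close>

lemma power_gegenbauer_expansion:
  assumes \<nu>: "\<nu> > - 1 / 2"
  shows "Gamma (\<nu> + 1) * (\<Sum>m\<le>n. neumann_coeff 2 1 \<nu> n m * gegenbauer_factor m \<nu> t)
    = (2 * t) ^ n / fact n"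
proof -
  define S where "S = (\<lambda>n. \<Sum>m\<le>n. neumann_coeff 2 1 \<nu> n m * gegenbauer_factor m \<nu> t)"
  have "real (Suc n) * S (Suc n) = 2 * t * S n" for n
    unfolding S_def
    by (subst two_t_times_gegenbauer_sum[OF \<nu>], simp add: neumann_coeff_def)
      (simp only: neumann_coeff_2_1_recurrence[OF \<nu>] sum_distrib_left mult.assoc[symmetric])
  then have step: "S (Suc n) = 2 * t * S n / real (Suc n)" for n
    by (simp add: field_simps)
  have "Gamma (\<nu> + 1) * S n = (2 * t) ^ n / fact n"
  proof (induction n)
    case 0
    show ?case
      using neumann_sum_0[of 1 \<nu> 2 t] \<nu> by (simp add: S_def)
  next
    case (Suc n)
    have "Gamma (\<nu> + 1) * S (Suc n) = 2 * t * (Gamma (\<nu> + 1) * S n) / real (Suc n)"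
      by (simp add: step)
    then show ?case
      unfolding Suc by simp
  qed
  then show ?thesis
    by (simp only: S_def)
qed

text \<open>
  The expansion of \<open>((1 + t) / 2) ^ n\<close>, normalized as a coefficient of \<open>scr_I 2 \<nu> w t\<close>. Its
  denominator \<open>n! \<Gamma>(\<nu> + 1 / 2 + n)\<close>, which is that of the Bessel series of index \<open>\<nu> - 1 / 2\<close>, picks up
  the factor \<open>(n + 1) (\<nu> + 1 / 2 + n)\<close> in each step.
\<close>

lemma shifted_power_gegenbauer_expansion:
  assumes \<nu>: "\<nu> > - 1 / 2"
  shows "Gamma (2 * \<nu> + 1) * (\<Sum>m\<le>n. neumann_coeff 1 2 \<nu> n m * gegenbauer_factor m \<nu> t)
    = Gamma (\<nu> + 1 / 2) * ((1 + t) / 2) ^ n / (fact n * Gamma (\<nu> + 1 / 2 + real n))"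
proof -
  define S where "S = (\<lambda>n. \<Sum>m\<le>n. neumann_coeff 1 2 \<nu> n m * gegenbauer_factor m \<nu> t)"
  let ?y = "\<lambda>n. \<nu> + 1 / 2 + real n"
  have y: "?y n > 0" for n
    using \<nu> by simp
  have step: "S (Suc n) = (1 + t) / 2 * S n / (real (Suc n) * ?y n)" for n
  proof -
    have ext: "S n = (\<Sum>m\<le>Suc n. neumann_coeff 1 2 \<nu> n m * gegenbauer_factor m \<nu> t)"
      by (simp add: S_def neumann_coeff_def)
    have "4 * real (Suc n) * (real n + \<nu> + 1 / 2) * S (Suc n)
        = (\<Sum>m\<le>Suc n. 4 * real (Suc n) * (real n + \<nu> + 1 / 2) * neumann_coeff 1 2 \<nu> (Suc n) m
            * gegenbauer_factor m \<nu> t)"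
      by (simp only: S_def sum_distrib_left mult.assoc)
    also have "\<dots> = 2 * S n + 2 * t * S n"
    proof -
      have "2 * t * S n = (\<Sum>m\<le>Suc n. ((case m of 0 \<Rightarrow> 0
            | Suc j \<Rightarrow> real m / (real m + \<nu>) * neumann_coeff 1 2 \<nu> n j)
          + lowering_coeff \<nu> m * neumann_coeff 1 2 \<nu> n (Suc m)) * gegenbauer_factor m \<nu> t)"
        unfolding S_def by (rule two_t_times_gegenbauer_sum[OF \<nu>]) (simp add: neumann_coeff_def)
      then show ?thesis
        unfolding neumann_coeff_1_2_recurrence[OF \<nu>] distrib_right[of "2 * _"] sum.distrib
        by (simp only: ext sum_distrib_left mult.assoc)
    qed
    finally have eq: "real (Suc n) * ?y n * S (Suc n) = (1 + t) / 2 * S n"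
      by (simp add: field_simps)
    have "real (Suc n) * ?y n \<noteq> 0"
      using y[of n] by simp
    from nonzero_mult_div_cancel_left[OF this, of "S (Suc n)"] show ?thesis
      unfolding eq by (rule sym)
  qed
  have "Gamma (2 * \<nu> + 1) * S n
      = Gamma (\<nu> + 1 / 2) * ((1 + t) / 2) ^ n / (fact n * Gamma (?y n))"
  proof (induction n)
    case 0
    have "Gamma (\<nu> + 1 / 2) \<noteq> 0"
      using \<nu> Gamma_real_pos[of "\<nu> + 1 / 2"] by linarith
    then show ?case
      using neumann_sum_0[of 2 \<nu> 1 t] \<nu> by (simp add: S_def)
  next
    case (Suc n)
    have "?y n \<notin> \<int>\<^sub>\<le>\<^sub>0"
      using y[of n] by auto
    then have "Gamma (?y n + 1) = ?y n * Gamma (?y n)"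
      by (rule Gamma_plus1)
    then have G: "Gamma (?y (Suc n)) = ?y n * Gamma (?y n)"
      by (simp add: add_ac)
    have "Gamma (2 * \<nu> + 1) * S (Suc n)
        = (1 + t) / 2 * (Gamma (2 * \<nu> + 1) * S n) / (real (Suc n) * ?y n)"
      by (simp add: step)
    also have "\<dots> = Gamma (\<nu> + 1 / 2) * ((1 + t) / 2) ^ Suc n / (fact (Suc n) * Gamma (?y (Suc n)))"
      unfolding Suc G by (simp add: mult_ac)
    finally show ?case .
  qed
  then show ?thesis
    by (simp only: S_def)
qed

section \<open>Rearranging the Bessel series\<close>

text \<open>
  Each step multiplies the Gamma function by \<open>x + n \<ge> \<delta> (1 + n)\<close>. So it grows like a
  factorial up to a geometric factor, uniformly enough to dominate the double series below.
\<close>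

lemma Gamma_add_nat_lower_bound:
  fixes x \<delta> :: real
  assumes "0 < \<delta>" "\<delta> \<le> 1" "\<delta> \<le> x"
  shows "Gamma x * \<delta> ^ n * fact n \<le> Gamma (x + real n)"
proof (induction n)
  case (Suc n)
  have x: "x > 0"
    using assms by linarith
  have "\<delta> * real (Suc n) \<le> x + real n"
    using assms mult_right_mono[of \<delta> 1 "real n"] by (simp add: algebra_simps)
  then have "Gamma x * \<delta> ^ n * fact n * (\<delta> * real (Suc n)) \<le> Gamma (x + real n) * (x + real n)"
    using Suc x assms by (intro mult_mono) (auto intro!: less_imp_le[OF Gamma_real_pos])
  also have "\<dots> = Gamma (x + real (Suc n))"
  proof -
    have "x + real n \<notin> \<int>\<^sub>\<le>\<^sub>0"
      using x by (intro notI) (auto dest!: nonpos_Ints_nonpos)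
    from Gamma_plus1[OF this] show ?thesis
      by (simp add: add_ac)
  qed
  finally show ?case
    by (simp add: mult_ac)
qed simp

lemma summable_on_exp_products:
  fixes P Q C :: real
  assumes "P \<ge> 0" "Q \<ge> 0" "C \<ge> 0"
  shows "(\<lambda>(m, l). C * (P ^ m / fact m) * (Q ^ l / fact l)) summable_on (UNIV :: (nat \<times> nat) set)"
proof -
  have e: "((\<lambda>n. x ^ n / fact n) has_sum exp x) UNIV" if "x \<ge> 0" for x :: real
    using that exp_converges[of x] summable_exp_generic[of x]
    by (intro norm_summable_imp_has_sum) (simp_all add: field_simps sums_iff)
  have "(\<lambda>(m, l). C * (P ^ m / fact m) * (Q ^ l / fact l))
      summable_on (SIGMA m:(UNIV::nat set). (UNIV::nat set))"
  proof (rule summable_on_SigmaI)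
    show "((\<lambda>l. case (m, l) of (m, l) \<Rightarrow> C * (P ^ m / fact m) * (Q ^ l / fact l))
        has_sum C * (P ^ m / fact m) * exp Q) UNIV" for m :: nat
      unfolding prod.case by (intro has_sum_cmult_right e assms)
    show "(\<lambda>m. C * (P ^ m / fact m) * exp Q) summable_on UNIV"
      using e[OF assms(1)] by (intro summable_on_cmult_left summable_on_cmult_right) (auto simp: summable_on_def)
  qed (use assms in auto)
  then show ?thesis by simp
qed

text \<open>
  Sorting the double series by powers of \<open>w\<close>. Both orders of summation compute the sum of one
  absolutely summable family \<open>F\<close> over \<open>(m, l)\<close>: its rows are the summands in the definition of
  \<open>scr_I\<close>, and its diagonals \<open>m + q l = n\<close> are the terms stated here, up to the Gamma prefactor.
\<close>

lemma scr_I_sums: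
  fixes q d :: nat
  assumes dq: "d * q = 2" and \<nu>: "\<nu> > - 1 / 2" and t: "t \<in> {-1..1}"
  shows "(\<lambda>n. of_real (Gamma (real d * \<nu> + 1)
            * (\<Sum>m\<le>n. neumann_coeff q d \<nu> n m * gegenbauer_factor m \<nu> t)) * (w / 2) ^ (d * n))
    sums scr_I (real d) \<nu> w t"
proof -
  have "d dvd 2"
    using dq by (metis dvd_triv_left)
  then have d: "d > 0" and q: "q > 0" "d \<le> 2"
    using dq by (auto intro!: Nat.gr0I dvd_imp_le)
  let ?c = "\<lambda>m. gegenbauer_factor m \<nu> t"
  define x where "x = real d * \<nu> + 1"
  define F :: "nat \<times> nat \<Rightarrow> complex" where
    "F = (\<lambda>(m, l). of_real (?c m) * (w / 2) ^ (d * (m + q * l))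
         / (fact l * of_real (Gamma (real d * (real m + \<nu>) + real l + 1))))"
  have x: "x > 0"
    using \<nu> d q(2) by (cases "d = 1") (auto simp: x_def le_Suc_eq numeral_2_eq_2)
  have F_summable: "F summable_on UNIV"
  proof -
    \<comment> \<open>The family is dominated by a product of two exponential series, in \<open>m\<close> and in \<open>l\<close>, because
      \<open>\<Gamma>(x + d m + l)\<close> is at least a multiple of \<open>\<delta> ^ (d m + l) m!\<close>.\<close>
    define \<delta> where "\<delta> = min 1 x"
    have \<delta>: "0 < \<delta>" "\<delta> \<le> 1" "\<delta> \<le> x"
      using x by (auto simp: \<delta>_def)
    define K where "K = 4 * (1 + \<bar>\<nu>\<bar>)\<^sup>2"
    have K: "K \<ge> 0"
      by (simp add: K_def)
    define \<rho> where "\<rho> = norm (w / 2)"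
    let ?P = "K * (\<rho> / \<delta>) ^ d" and ?Q = "\<rho>\<^sup>2 / \<delta>"
    have "norm (F (m, l)) \<le> 1 / Gamma x * (?P ^ m / fact m) * (?Q ^ l / fact l)" for m l
    proof -
      let ?n = "d * m + l"
      have arg: "real d * (real m + \<nu>) + real l + 1 = x + real ?n"
        by (simp add: x_def algebra_simps)
      have G: "Gamma x > 0" "Gamma (x + real ?n) > 0"
        using x by (auto intro!: Gamma_real_pos add_pos_nonneg)
      have "m \<le> ?n"
        using d by (cases d) auto
      then have "Gamma x * \<delta> ^ ?n * fact m \<le> Gamma x * \<delta> ^ ?n * fact ?n"
        using G \<delta> by (intro mult_left_mono fact_mono) auto
      also have "\<dots> \<le> Gamma (x + real ?n)"
        by (rule Gamma_add_nat_lower_bound[OF \<delta>])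
      finally have low: "Gamma x * \<delta> ^ ?n * fact m \<le> Gamma (x + real ?n)" .
      have "norm (F (m, l)) = \<bar>?c m\<bar> * \<rho> ^ (d * (m + q * l)) / (fact l * Gamma (x + real ?n))"
        using G by (simp add: F_def arg norm_mult norm_divide norm_power \<rho>_def)
      also have "\<dots> \<le> K ^ m * \<rho> ^ (d * (m + q * l)) / (fact l * (Gamma x * \<delta> ^ ?n * fact m))"
        using gegenbauer_factor_bound[OF \<nu> t, of m] low G \<delta> K
        by (intro frac_le mult_mono mult_nonneg_nonneg mult_pos_pos) (auto simp: K_def \<rho>_def)
      also have "d * (m + q * l) = d * m + 2 * l"
        using dq by (simp add: distrib_left mult.assoc[symmetric])
      also have "K ^ m * \<rho> ^ (d * m + 2 * l) / (fact l * (Gamma x * \<delta> ^ ?n * fact m))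
          = 1 / Gamma x * (?P ^ m / fact m) * (?Q ^ l / fact l)"
        by (simp only: power_mult_distrib power_divide power_add power_mult) (simp add: mult_ac)
      finally show ?thesis .
    qed
    moreover have "?P \<ge> 0" "?Q \<ge> 0" "1 / Gamma x \<ge> 0"
      using K \<delta> x by (auto simp: \<rho>_def intro!: less_imp_le[OF Gamma_real_pos])
    ultimately have "(\<lambda>p. norm (F p)) summable_on UNIV"
      by (intro Infinite_Sum.abs_summable_on_comparison_test'[OF summable_on_exp_products[of ?P ?Q "1 / Gamma x"]])
        auto
    then show ?thesis
      by (rule Infinite_Sum.abs_summable_summable)
  qed
  then obtain S where S: "(F has_sum S) UNIV"
    by (auto simp: summable_on_def)
  have rows: "(\<lambda>m. (if m = 0 then 1 else (w / 2) powr of_real (real d * real m)) *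
           bessel_I_norm (real d * (real m + \<nu>)) w * of_real (?c m)) sums S"
  proof -
    have "F summable_on (SIGMA m:UNIV. UNIV)"
      using F_summable by simp
    then have row: "((\<lambda>l. F (m, l)) has_sum (\<Sum>\<^sub>\<infinity>l. F (m, l))) UNIV" for m
      using summable_on_SigmaD1[where f = "\<lambda>m l. F (m, l)" and A = UNIV and B = "\<lambda>_. UNIV" and x = m]
      by (simp add: has_sum_infsum)
    have "((\<lambda>m. \<Sum>\<^sub>\<infinity>l. F (m, l)) has_sum S) UNIV"
      by (rule has_sum_SigmaD[where f = F and A = UNIV and B = "\<lambda>_. UNIV"]) (use S row in auto)
    then have "(\<lambda>m. \<Sum>\<^sub>\<infinity>l. F (m, l)) sums S"
      by (rule has_sum_imp_sums)
    moreover have "(\<Sum>\<^sub>\<infinity>l. F (m, l)) = (if m = 0 then 1 else (w / 2) powr of_real (real d * real m)) *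
           bessel_I_norm (real d * (real m + \<nu>)) w * of_real (?c m)" for m
    proof -
      define b where "b = (\<lambda>l. w ^ (2 * l) / (2 ^ (2 * l) * fact l *
        complex_of_real (Gamma (real d * (real m + \<nu>) + real l + 1))))"
      let ?p = "of_real (?c m) * (w / 2) ^ (d * m)"
      have "d * (m + q * l) = d * m + 2 * l" for l
        using dq by (simp add: distrib_left mult.assoc[symmetric])
      then have Fb: "F (m, l) = ?p * b l" for l
        by (simp add: F_def b_def power_add power_divide) (simp add: mult.assoc)
      have sm: "(\<lambda>l. ?p * b l) sums (\<Sum>\<^sub>\<infinity>l. F (m, l))"
        using has_sum_imp_sums[OF row[of m]] by (simp only: Fb)
      \<comment> \<open>If the prefactor vanishes, summability of the row says nothing about \<open>b\<close>, but then both
        sides are 0.\<close>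
      have "(\<Sum>\<^sub>\<infinity>l. F (m, l)) = ?p * suminf b"
      proof (cases "?p = 0")
        case True
        have "(\<lambda>l. 0 * b l) sums (\<Sum>\<^sub>\<infinity>l. F (m, l))"
          using sm unfolding True .
        then show ?thesis
          unfolding True by (simp add: sums_iff)
      next
        case False
        then have "summable b"
          using sm summable_cmult_iff sums_summable by metis
        then show ?thesis
          using sm by (simp add: sums_iff suminf_mult)
      qed
      moreover have "suminf b = bessel_I_norm (real d * (real m + \<nu>)) w"
        by (simp add: bessel_I_norm_def b_def)
      moreover have "(if m = 0 then 1 else (w / 2) powr of_real (real d * real m)) = (w / 2) ^ (d * m)"
      proof (cases "m = 0")
        case False
        have "(w / 2) powr of_nat (d * m) = (w / 2) ^ (d * m)"
          using False d by (intro powr_nat') auto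
        then show ?thesis
          using False by simp
      qed simp
      ultimately show ?thesis
        by (simp add: mult_ac)
    qed
    ultimately show ?thesis by (simp only:)
  qed
  have diagonals: "(\<lambda>n. of_real (\<Sum>m\<le>n. neumann_coeff q d \<nu> n m * ?c m) * (w / 2) ^ (d * n)) sums S"
  proof -
    define H :: "nat \<times> nat \<Rightarrow> complex" where
      "H = (\<lambda>(n, m). of_real (neumann_coeff q d \<nu> n m * ?c m) * (w / 2) ^ (d * n))"
    \<comment> \<open>The change of index is injective but not onto \<open>{(n, m). m \<le> n}\<close> if \<open>q = 2\<close>; \<open>H\<close> is 0 at the
      pairs that it misses.\<close>
    define h where "h = (\<lambda>(m, l). (m + q * l, m))"
    have "inj h"
      using q by (auto simp: inj_on_def h_def)
    moreover have "H \<circ> h = F"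
      using q by (auto simp: fun_eq_iff H_def h_def F_def neumann_coeff_eq)
    ultimately have "(H has_sum S) (range h)"
      using S by (simp add: has_sum_reindex)
    moreover have "H p = 0" if "p \<notin> range h" for p
    proof (cases p)
      case (Pair n m)
      have "n \<noteq> m + q * l" for l
      proof
        assume "n = m + q * l"
        then have "p = h (m, l)"
          by (simp add: Pair h_def)
        with that show False
          by blast
      qed
      then have "neumann_coeff q d \<nu> n m = 0"
        using neumann_coeff_cases[where n = n and m = m and q = q and d = d and \<nu> = \<nu>] by blast
      then show ?thesis
        by (simp add: H_def Pair)
    qed
    moreover have "range h \<subseteq> (SIGMA n:UNIV. {..n})"
      by (auto simp: h_def)
    ultimately have "(H has_sum S) (SIGMA n:UNIV. {..n})"
      using has_sum_cong_neutral[of "SIGMA n:UNIV. {..n}" "range h" H H S] by blast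
    then have "((\<lambda>n. \<Sum>m\<le>n. H (n, m)) has_sum S) UNIV"
      by (rule has_sum_SigmaD) (simp add: has_sum_finite)
    then show ?thesis
      by (simp add: H_def sum_distrib_right has_sum_imp_sums)
  qed
  have "scr_I (real d) \<nu> w t = of_real (Gamma (real d * \<nu> + 1)) * S"
    unfolding scr_I_def using rows by (simp add: sums_iff)
  then show ?thesis
    using sums_mult[OF diagonals, of "of_real (Gamma (real d * \<nu> + 1))"] by (simp add: mult.assoc)
qed

section \<open>Closed forms\<close>

text \<open>
  Gegenbauer's expansion of a plane wave in Bessel functions.
\<close>

lemma scr_I_1_eq_exp:
  assumes "\<nu> > - 1 / 2" "t \<in> {-1..1}"
  shows "scr_I 1 \<nu> w t = exp (w * of_real t)"
proof -
  have "(\<lambda>n. of_real ((2 * t) ^ n / fact n) * (w / 2) ^ n) sums scr_I 1 \<nu> w t"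
    using scr_I_sums[of 1 2 \<nu> t w, OF _ assms] unfolding of_nat_1 mult_1
    by (simp only: power_gegenbauer_expansion[OF assms(1)])
  moreover have "of_real ((2 * t) ^ n / fact n) * (w / 2) ^ n = (w * of_real t) ^ n /\<^sub>R fact n" for n
    by (simp add: power_mult_distrib power_divide scaleR_conv_of_real field_simps)
  ultimately have "(\<lambda>n. (w * of_real t) ^ n /\<^sub>R fact n) sums scr_I 1 \<nu> w t"
    by (simp only:)
  then show ?thesis
    using exp_converges sums_unique2 by blast
qed

text \<open>
  In the Bessel series of the right-hand side, only even powers of \<open>sqrt ((1 + t) / 2)\<close> occur, so its
  terms carry the powers of \<open>(1 + t) / 2\<close> found above.
\<close>

lemma scr_I_2_eq_bessel_I_norm:
  assumes "\<nu> > - 1 / 2" "t \<in> {-1..1}"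
  shows "scr_I 2 \<nu> w t = of_real (Gamma (\<nu> + 1 / 2))
    * bessel_I_norm (\<nu> - 1 / 2) (w * of_real (sqrt ((1 + t) / 2)))"
proof -
  let ?G = "Gamma (\<nu> + 1 / 2)"
  let ?u = "w * of_real (sqrt ((1 + t) / 2))"
  have G: "?G \<noteq> 0"
    using Gamma_real_pos[of "\<nu> + 1 / 2"] assms(1) by linarith
  define b where "b = (\<lambda>n. ?u ^ (2 * n) / (2 ^ (2 * n) * fact n *
    complex_of_real (Gamma (\<nu> - 1 / 2 + real n + 1))))"
  have "(\<lambda>n. of_real (?G * ((1 + t) / 2) ^ n / (fact n * Gamma (\<nu> + 1 / 2 + real n))) * (w / 2) ^ (2 * n))
      sums scr_I 2 \<nu> w t"
    using scr_I_sums[of 2 1 \<nu> t w, OF _ assms] unfolding of_nat_numeral mult_1_right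
    by (simp only: shifted_power_gegenbauer_expansion[OF assms(1)])
  moreover have "of_real (?G * ((1 + t) / 2) ^ n / (fact n * Gamma (\<nu> + 1 / 2 + real n))) * (w / 2) ^ (2 * n)
      = of_real ?G * b n" for n
  proof -
    have "complex_of_real (sqrt ((1 + t) / 2)) ^ (2 * n) = of_real ((1 + t) / 2) ^ n"
      using assms(2) by (simp only: power_mult of_real_power[symmetric]) simp
    then have "?u ^ (2 * n) = w ^ (2 * n) * of_real ((1 + t) / 2) ^ n"
      by (simp only: power_mult_distrib)
    moreover have "\<nu> - 1 / 2 + real n + 1 = \<nu> + 1 / 2 + real n"
      by simp
    ultimately show ?thesis
      unfolding b_def by (simp only:) (simp add: power_divide mult_ac)
  qed
  ultimately have "(\<lambda>n. of_real ?G * b n) sums scr_I 2 \<nu> w t"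
    by (simp only:)
  moreover from this have "summable b"
    using G summable_cmult_iff sums_summable by (metis of_real_eq_0_iff)
  ultimately have "scr_I 2 \<nu> w t = of_real ?G * suminf b"
    by (simp add: sums_iff suminf_mult)
  then show ?thesis
    by (simp add: b_def bessel_I_norm_def)
qed

theorem theorem4p24:
  fixes R :: "(real ^ 'n) set" and k :: "real ^ 'n \<Rightarrow> real"
    and a r s t :: real and z :: complex
  assumes "reduced_root_system R"
    and "multiplicity_function R k"
    and "\<forall>\<alpha>\<in>R. k \<alpha> \<ge> 0"
    and "2 * mult_index R k + real CARD('n) > 1"
    and "a \<in> {1, 2}"
    and "r > 0" and "s > 0"
    and "t \<in> {-1..1}"
    and "Re z \<ge> 0"
    and "z \<notin> range (\<lambda>n::int. \<i> * of_real pi * of_int n)"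
  shows "h_kernel R k a r s z t =
    exp (- of_real (1 / a * (r powr a + s powr a)) * (cosh z / sinh z))
      / sinh_power z ((2 * mult_index R k + real CARD('n) + a - 2) / a)
    * (if a = 1
       then of_real (Gamma (mult_index R k + (real CARD('n) - 1) / 2))
            * bessel_I_norm (mult_index R k + (real CARD('n) - 3) / 2)
                (of_real (sqrt 2 * sqrt (r * s)) / sinh z * of_real (sqrt (1 + t)))
       else exp (of_real (r * s * t) / sinh z))"
proof -
  define \<nu> where "\<nu> = (2 * mult_index R k + real CARD('n) - 2) / 2"
  have \<nu>: "\<nu> > - 1 / 2"
    using assms(4) by (simp add: \<nu>_def)
  let ?w = "of_real (2 * (r * s) powr (a / 2)) / (of_real a * sinh z)"
  have "scr_I (2 / a) \<nu> ?w t = (if a = 1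
       then of_real (Gamma (mult_index R k + (real CARD('n) - 1) / 2))
            * bessel_I_norm (mult_index R k + (real CARD('n) - 3) / 2)
                (of_real (sqrt 2 * sqrt (r * s)) / sinh z * of_real (sqrt (1 + t)))
       else exp (of_real (r * s * t) / sinh z))"
  proof (cases "a = 1")
    case True
    have half: "2 * sqrt ((1 + t) / 2) = sqrt 2 * sqrt (1 + t)"
      by (simp add: real_sqrt_divide) (simp add: field_simps)
    have "2 * sqrt (r * s) * sqrt ((1 + t) / 2) = sqrt (r * s) * (2 * sqrt ((1 + t) / 2))"
      by (simp only: mult_ac)
    also have "\<dots> = sqrt 2 * sqrt (r * s) * sqrt (1 + t)"
      by (simp only: half mult_ac)
    finally have "complex_of_real (2 * sqrt (r * s)) * of_real (sqrt ((1 + t) / 2))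
        = of_real (sqrt 2 * sqrt (r * s)) * of_real (sqrt (1 + t))"
      by (simp only: of_real_mult[symmetric])
    moreover have "?w = of_real (2 * sqrt (r * s)) / sinh z"
      using True assms(6,7) by (simp add: powr_half_sqrt)
    ultimately have arg: "?w * of_real (sqrt ((1 + t) / 2))
        = of_real (sqrt 2 * sqrt (r * s)) / sinh z * of_real (sqrt (1 + t))"
      by (simp only: times_divide_eq_left)
    have "scr_I (2 / a) \<nu> ?w t = of_real (Gamma (\<nu> + 1 / 2))
        * bessel_I_norm (\<nu> - 1 / 2) (?w * of_real (sqrt ((1 + t) / 2)))"
      using scr_I_2_eq_bessel_I_norm[OF \<nu> assms(8)] True by simp
    also have "\<nu> + 1 / 2 = mult_index R k + (real CARD('n) - 1) / 2"
      by (simp add: \<nu>_def field_simps)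
    also have "\<nu> - 1 / 2 = mult_index R k + (real CARD('n) - 3) / 2"
      by (simp add: \<nu>_def field_simps)
    finally show ?thesis
      unfolding arg using True by simp
  next
    case False
    then have "a = 2"
      using assms(5) by simp
    then show ?thesis
      using scr_I_1_eq_exp[OF \<nu> assms(8)] assms(6,7) by simp
  qed
  then show ?thesis
    unfolding h_kernel_def \<nu>_def[symmetric] by (simp only:)
qed

end
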